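(* Let $X$ and $Y$ be real Banach spaces and let $T:Y\to X$ be a bounded linear operator. Then $T$ is completely continuous if and only if for every Lipschitz function $f:X\to\mathbb{R}$ and every $y\in Y$, the function $f\circ T$ is weak-Hadamard differentiable at $y$ whenever $f$ is Gâteaux differentiable (equivalently, Hadamard differentiable) at $Ty$.
   Context: $T$ is completely continuous (Dunford-Pettis) if for every weakly convergent sequence $(y_n)$ in $Y$ the sequence $(Ty_n)$ is norm-convergent in $X$. For a family $\beta$ of bounded nonempty subsets of a Banach space $X$, a function $f:X\to\mathbb{R}$ is $\beta$-differentiable at $x_0\in X$ if there is a bounded linear functional $d_\beta f(x_0):X\to\mathbb{R}$ such that $\lim_{t\to 0}\sup_{u\in A}\left|\frac{f(x_0+tu)-f(x_0)}{t}-d_\beta f(x_0)(u)\right|=0$ for every $A\in\beta$. Gâteaux, Hadamard and weak-Hadamard differentiability are $\beta$-differentiability for $\beta$ the family of all nonempty finite sets, of all nonempty relatively norm-compact sets, and of all nonempty relatively weakly compact sets, respectively. For real-valued Lipschitz functions, Gâteaux and Hadamard differentiability at a point coincide. *)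

theory Defs
  imports "HOL-Analysis.Analysis"
begin

definition weak_topology :: "'a::real_normed_vector topology" where
  "weak_topology =
     topology_generated_by {\<phi> -` U |(\<phi> :: 'a \<Rightarrow> real) U. bounded_linear \<phi> \<and> open U}"

lemma topspace_weak_topology [simp]: "topspace weak_topology = UNIV"
proof -
  have "(\<lambda>_::'a. 0::real) -` UNIV \<in> {\<phi> -` U |(\<phi> :: 'a \<Rightarrow> real) U. bounded_linear \<phi> \<and> open U}"
    using bounded_linear_zero open_UNIV by blast
  then show ?thesis
    unfolding weak_topology_def topology_generated_by_topspace by auto
qed

lemma limitin_weak_topology_iff:
  fixes l :: "'a::real_normed_vector"
  shows "limitin weak_topology y l F \<longleftrightarrow>
    (\<forall>\<phi> :: 'a \<Rightarrow> real. bounded_linear \<phi> \<longrightarrow> ((\<lambda>n. \<phi> (y n)) \<longlongrightarrow> \<phi> l) F)"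
proof
  assume L: "limitin weak_topology y l F"
  show "\<forall>\<phi> :: 'a \<Rightarrow> real. bounded_linear \<phi> \<longrightarrow> ((\<lambda>n. \<phi> (y n)) \<longlongrightarrow> \<phi> l) F"
  proof (intro allI impI topological_tendstoI)
    fix \<phi> :: "'a \<Rightarrow> real" and S
    assume "bounded_linear \<phi>" "open S" and l: "\<phi> l \<in> S"
    then have "openin weak_topology (\<phi> -` S)"
      unfolding weak_topology_def by (intro topology_generated_by_Basis) auto
    with L l show "\<forall>\<^sub>F n in F. \<phi> (y n) \<in> S"
      unfolding limitin_def by auto
  qed
next
  assume R: "\<forall>\<phi> :: 'a \<Rightarrow> real. bounded_linear \<phi> \<longrightarrow> ((\<lambda>n. \<phi> (y n)) \<longlongrightarrow> \<phi> l) F"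
  have "l \<in> V \<longrightarrow> (\<forall>\<^sub>F n in F. y n \<in> V)"
    if "generate_topology_on {\<phi> -` U |(\<phi> :: 'a \<Rightarrow> real) U. bounded_linear \<phi> \<and> open U} V" for V
    using that
  proof induction
    case Empty
    then show ?case by simp
  next
    case (Int a b)
    then show ?case by (auto intro: eventually_conj)
  next
    case (UN K)
    show ?case
    proof
      assume "l \<in> \<Union>K"
      then obtain k where k: "k \<in> K" "l \<in> k" by blast
      then have "\<forall>\<^sub>F n in F. y n \<in> k" using UN by blast
      then show "\<forall>\<^sub>F n in F. y n \<in> \<Union>K"
        by (rule eventually_mono) (use k in blast)
    qed
  next
    case (Basis s)
    then show ?case using R by (force dest: topological_tendstoD)
  qed
  then show "limitin weak_topology y l F"
    by (simp add: limitin_def) (simp add: weak_topology_def openin_topology_generated_by_iff)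
qed

definition completely_continuous ::
    "('b::real_normed_vector \<Rightarrow> 'a::real_normed_vector) \<Rightarrow> bool" where
  "completely_continuous T \<longleftrightarrow>
     (\<forall>y. (\<exists>l. limitin weak_topology y l sequentially) \<longrightarrow> convergent (\<lambda>n. T (y n)))"

text \<open>The supremum is taken in the extended reals, since a real supremum over an unbounded set of
  values would be an unspecified number.\<close>

definition beta_differentiable_at ::
    "'a::real_normed_vector set set \<Rightarrow> ('a \<Rightarrow> real) \<Rightarrow> 'a \<Rightarrow> bool" where
  "beta_differentiable_at \<beta> f x \<longleftrightarrow>
     (\<exists>D. bounded_linear D \<and>
       (\<forall>A\<in>\<beta>. ((\<lambda>t. SUP u\<in>A. ereal \<bar>(f (x + t *\<^sub>R u) - f x) / t - D u\<bar>) \<longlongrightarrow> 0) (at (0::real))))"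

definition gateaux_differentiable_at ::
    "('a::real_normed_vector \<Rightarrow> real) \<Rightarrow> 'a \<Rightarrow> bool" where
  "gateaux_differentiable_at = beta_differentiable_at {A. A \<noteq> {} \<and> finite A}"

definition hadamard_differentiable_at ::
    "('a::real_normed_vector \<Rightarrow> real) \<Rightarrow> 'a \<Rightarrow> bool" where
  "hadamard_differentiable_at = beta_differentiable_at {A. A \<noteq> {} \<and> compact (closure A)}"

text \<open>No boundedness needs to be required of the sets below: relatively weakly compact sets are
  bounded by the uniform boundedness principle.\<close>

definition weak_hadamard_differentiable_at ::
    "('a::real_normed_vector \<Rightarrow> real) \<Rightarrow> 'a \<Rightarrow> bool" where
  "weak_hadamard_differentiable_at =
     beta_differentiable_at
       {A. A \<noteq> {} \<and> compactin weak_topology (weak_topology closure_of A)}"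

end

theory Submission
  imports Defs
begin

text \<open>If \<open>T\<close> is completely continuous, it maps weakly compact sets to norm compact sets, because
  weakly compact sets are weakly sequentially compact (the Smulian half of the Eberlein-Smulian
  theorem). The difference quotients of a Lipschitz function are equi-Lipschitz in the direction, so
  their pointwise convergence is uniform over compact sets of directions. Conversely, if \<open>T\<close> is not
  completely continuous, there is a weakly null sequence \<open>z n\<close> with \<open>norm (T (z n))\<close> bounded below.
  A Lipschitz function made of bumps of height proportional to \<open>1 / (n + 1)\<close> at \<open>T (z n) / (n + 1)\<close>
  vanishes near the origin on every line, but its difference quotients do not converge uniformly over
  the relatively weakly compact set of the \<open>z n\<close>.\<close>

section \<open>Hahn-Banach\<close>

definition sublinear :: "('a::real_vector \<Rightarrow> real) \<Rightarrow> bool" where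
  "sublinear q \<longleftrightarrow> (\<forall>x y. q (x + y) \<le> q x + q y) \<and> (\<forall>c x. c > 0 \<longrightarrow> q (c *\<^sub>R x) = c * q x)"

text \<open>The inequality for the factor \<open>inverse c\<close> supplies the reverse inequality
  for \<open>c\<close>. This suits functionals defined as infima, where one direction is
  immediate.\<close>

lemma sublinearI:
  assumes add: "\<And>x y. q (x + y) \<le> q x + q y"
    and scale: "\<And>c x. c > 0 \<Longrightarrow> q (c *\<^sub>R x) \<le> c * q x"
  shows "sublinear q"
proof -
  have "q (c *\<^sub>R x) = c * q x" if "c > 0" for c x
  proof (rule antisym)
    have "q (inverse c *\<^sub>R (c *\<^sub>R x)) \<le> inverse c * q (c *\<^sub>R x)"
      using that by (intro scale) simp
    then show "c * q x \<le> q (c *\<^sub>R x)"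
      using that by (simp add: field_simps)
  qed (use scale that in simp)
  with add show ?thesis by (simp add: sublinear_def)
qed

lemma
  assumes "sublinear q"
  shows sublinear_add: "q (x + y) \<le> q x + q y"
    and sublinear_scaleR: "c > 0 \<Longrightarrow> q (c *\<^sub>R x) = c * q x"
  using assms by (simp_all add: sublinear_def)

lemma sublinear_0:
  assumes "sublinear q"
  shows "q 0 = 0"
  using sublinear_scaleR[OF assms, of 2 0] by simp

lemma sublinear_scaleR':
  assumes "sublinear q" "c \<ge> 0"
  shows "q (c *\<^sub>R x) = c * q x"
  using assms by (cases "c = 0") (simp_all add: sublinear_0 sublinear_scaleR)

lemma sublinear_minus:
  assumes "sublinear q"
  shows "- q (- x) \<le> q x"
  using sublinear_add[OF assms, of x "- x"] sublinear_0[OF assms] by simp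

text \<open>Negative scalars factor through negation; the missing half of additivity is
  subadditivity applied to \<open>x + y\<close> and \<open>- y\<close>.\<close>

lemma sublinear_odd_imp_linear:
  assumes q: "sublinear q" and odd: "\<And>x. q (- x) \<le> - q x"
  shows "linear q"
proof -
  have neg: "q (- x) = - q x" for x
    using odd[of x] sublinear_minus[OF q, of x] by simp
  have scale: "q (c *\<^sub>R x) = c * q x" for c x
  proof (cases "c \<ge> 0")
    case False
    then have "q (- ((- c) *\<^sub>R x)) = - (- c * q x)"
      by (subst neg, subst sublinear_scaleR'[OF q]) auto
    then show ?thesis by simp
  qed (simp add: sublinear_scaleR'[OF q])
  have "q (x + y) = q x + q y" for x y
  proof (rule antisym)
    show "q x + q y \<le> q (x + y)"
      using sublinear_add[OF q, of "x + y" "- y"] by (simp add: neg)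
  qed (rule sublinear_add[OF q])
  then show ?thesis by (intro linearI) (simp_all add: scale)
qed

text \<open>The candidate is the infimum of \<open>q (x + t *\<^sub>R z) - t * q z\<close> over
  \<open>t \<ge> 0\<close>. The choice t = 0 puts it below \<open>q\<close>, and t = 1 at
  \<open>- z\<close> gives the last bound. For a minimal \<open>q\<close> this yields
  oddness.\<close>

lemma sublinear_shrink:
  assumes q: "sublinear q"
  shows "\<exists>r. sublinear r \<and> r \<le> q \<and> r (- z) \<le> - q z"
proof -
  define r where "r x = (INF t\<in>{0..}. q (x + t *\<^sub>R z) - t * q z)" for x
  \<comment> \<open>Subadditivity for t z = (x + t z) - x bounds the values from below, so
    \<open>r x\<close> is a genuine real infimum.\<close>
  have bdd: "bdd_below ((\<lambda>t. q (x + t *\<^sub>R z) - t * q z) ` {0..})" for x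
  proof (rule bdd_belowI2)
    fix t :: real assume "t \<in> {0..}"
    then show "- q (- x) \<le> q (x + t *\<^sub>R z) - t * q z"
      using sublinear_add[OF q, of "x + t *\<^sub>R z" "- x"] sublinear_scaleR'[OF q, of t z] by simp
  qed
  have le: "r x \<le> q (x + t *\<^sub>R z) - t * q z" if "t \<ge> 0" for x t
    unfolding r_def using that by (intro cINF_lower[OF bdd]) simp
  have ge: "m \<le> r x" if "\<And>t. t \<ge> 0 \<Longrightarrow> m \<le> q (x + t *\<^sub>R z) - t * q z" for m x
    unfolding r_def by (intro cINF_greatest that) auto
  have "sublinear r"
  proof (rule sublinearI)
    fix x y
    have "r (x + y) - (q (y + t *\<^sub>R z) - t * q z) \<le> r x" if "t \<ge> 0" for t
    proof (rule ge)
      fix s :: real assume "s \<ge> 0"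
      then have "r (x + y) \<le> q ((x + s *\<^sub>R z) + (y + t *\<^sub>R z)) - (s + t) * q z"
        using le[of "s + t" "x + y"] that by (simp add: algebra_simps)
      with sublinear_add[OF q, of "x + s *\<^sub>R z" "y + t *\<^sub>R z"]
      show "r (x + y) - (q (y + t *\<^sub>R z) - t * q z) \<le> q (x + s *\<^sub>R z) - s * q z"
        by (simp add: algebra_simps)
    qed
    then have "r (x + y) - r x \<le> r y"
      by (intro ge) (force simp: algebra_simps)
    then show "r (x + y) \<le> r x + r y" by simp
  next
    fix c :: real and x assume c: "c > 0"
    have "inverse c * r (c *\<^sub>R x) \<le> r x"
    proof (rule ge)
      fix t :: real assume "t \<ge> 0"
      then have "r (c *\<^sub>R x) \<le> q (c *\<^sub>R (x + t *\<^sub>R z)) - c * t * q z"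
        using le[of "c * t" "c *\<^sub>R x"] c by (simp add: algebra_simps)
      then show "inverse c * r (c *\<^sub>R x) \<le> q (x + t *\<^sub>R z) - t * q z"
        unfolding sublinear_scaleR[OF q c] using c by (simp add: field_simps)
    qed
    then show "r (c *\<^sub>R x) \<le> c * r x" using c by (simp add: field_simps)
  qed
  moreover have "r \<le> q" using le[of 0] by (simp add: le_fun_def)
  moreover have "r (- z) \<le> - q z" using le[of 1 "- z"] by (simp add: sublinear_0[OF q])
  ultimately show ?thesis by blast
qed

text \<open>Zorn's lemma for the pointwise order: the pointwise infimum of a chain is sublinear. It
  is finite because every sublinear functional below \<open>p\<close> is at least
  \<open>- p (- x)\<close> at \<open>x\<close>.\<close>

lemma exists_minimal_sublinear:
  assumes p: "sublinear p"
  shows "\<exists>q. sublinear q \<and> q \<le> p \<and> (\<forall>r. sublinear r \<and> r \<le> q \<longrightarrow> r = q)"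
proof -
  define A where "A = {q. sublinear q \<and> q \<le> p}"
  \<comment> \<open>Zorn's lemma yields maximal elements, so the order is reversed.\<close>
  have "\<exists>m\<in>A. \<forall>a\<in>A. m \<ge> a \<longrightarrow> a = m"
  proof (rule predicate_Zorn)
    show "partial_order_on A (relation_of (\<ge>) A)"
      by (rule partial_order_on_relation_ofI) auto
  next
    fix C assume C: "C \<in> Chains (relation_of (\<ge>) A)"
    show "\<exists>u\<in>A. \<forall>a\<in>C. a \<ge> u"
    proof (cases "C = {}")
      case True
      then show ?thesis using p by (auto simp: A_def)
    next
      case False
      have CA: "q \<in> A" if "q \<in> C" for q
        using C that by (auto simp: Chains_def relation_of_def)
      have tot: "q \<le> r \<or> r \<le> q" if "q \<in> C" "r \<in> C" for q r
        using C that by (auto simp: Chains_def relation_of_def)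
      define u where "u x = (INF q\<in>C. q x)" for x
      have bdd: "bdd_below ((\<lambda>q. q x) ` C)" for x
      proof (rule bdd_belowI2)
        fix q assume "q \<in> C"
        then have "sublinear q" "q (- x) \<le> p (- x)" using CA by (auto simp: A_def le_fun_def)
        then show "- p (- x) \<le> q x" using sublinear_minus[of q x] by linarith
      qed
      have le: "u x \<le> q x" if "q \<in> C" for q x
        unfolding u_def using that by (intro cINF_lower[OF bdd])
      have ge: "m \<le> u x" if "\<And>q. q \<in> C \<Longrightarrow> m \<le> q x" for m x
        unfolding u_def using False by (intro cINF_greatest that) auto
      have "sublinear u"
      proof (rule sublinearI)
        fix x y
        \<comment> \<open>Comparability in the chain enters here: one member \<open>s\<close> lies
          below both \<open>q\<close> and \<open>r\<close>, and its subadditivity bounds the mixed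
          sum.\<close>
        have *: "u (x + y) \<le> q x + r y" if qr: "q \<in> C" "r \<in> C" for q r
        proof -
          obtain s where s: "s \<in> C" "s \<le> q" "s \<le> r" using tot[OF qr] qr by blast
          have "u (x + y) \<le> s (x + y)" using le s by blast
          also have "\<dots> \<le> s x + s y" using CA[OF s(1)] by (auto simp: A_def sublinear_add)
          also have "\<dots> \<le> q x + r y" using s by (auto simp: le_fun_def intro: add_mono)
          finally show ?thesis .
        qed
        have "u (x + y) - r y \<le> u x" if "r \<in> C" for r
          by (rule ge) (use * that in \<open>force simp: algebra_simps\<close>)
        then have "u (x + y) - u x \<le> u y"
          by (intro ge) (force simp: algebra_simps)
        then show "u (x + y) \<le> u x + u y" by simp
      next
        fix c :: real and x assume c: "c > 0"
        have "inverse c * u (c *\<^sub>R x) \<le> u x"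
        proof (rule ge)
          fix q assume q: "q \<in> C"
          then have "u (c *\<^sub>R x) \<le> c * q x"
            using le[OF q, of "c *\<^sub>R x"] CA[OF q] c by (simp add: A_def sublinear_scaleR)
          then show "inverse c * u (c *\<^sub>R x) \<le> q x" using c by (simp add: field_simps)
        qed
        then show "u (c *\<^sub>R x) \<le> c * u x" using c by (simp add: field_simps)
      qed
      moreover have "u \<le> p"
      proof -
        obtain q where "q \<in> C" using False by blast
        then have "u \<le> q" "q \<le> p" using le CA by (auto simp: le_fun_def A_def)
        then show ?thesis by simp
      qed
      ultimately show ?thesis using le by (auto simp: A_def le_fun_def)
    qed
  qed
  then show ?thesis
    by (force simp: A_def)
qed

text \<open>A minimal sublinear functional cannot be shrunk in any direction, which makes it linear.\<close>

theorem Hahn_Banach_support: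
  assumes p: "sublinear p"
  shows "\<exists>\<phi>. linear \<phi> \<and> (\<forall>x. \<phi> x \<le> p x) \<and> \<phi> z = p z"
proof -
  \<comment> \<open>Shrinking in the direction \<open>z\<close> before minimizing forces equality at
    \<open>z\<close>: every functional below \<open>r\<close> is at most \<open>- p z\<close> at
    \<open>- z\<close>.\<close>
  obtain r where r: "sublinear r" "r \<le> p" "r (- z) \<le> - p z"
    using sublinear_shrink[OF p] by blast
  obtain q where q: "sublinear q" "q \<le> r" and min: "\<And>s. sublinear s \<Longrightarrow> s \<le> q \<Longrightarrow> s = q"
    using exists_minimal_sublinear[OF r(1)] by blast
  have "q (- x) \<le> - q x" for x
    using sublinear_shrink[OF q(1)] min by metis
  then have lin: "linear q" by (rule sublinear_odd_imp_linear[OF q(1)])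
  have le: "q x \<le> p x" for x
    using q(2) r(2) by (meson le_funD order_trans)
  have "q (- z) \<le> - p z" using q(2) r(3) by (meson le_funD order_trans)
  then have "q z = p z" using le[of z] linear_neg[OF lin, of z] by simp
  with lin le show ?thesis by blast
qed

lemma linear_le_norm_imp_bounded_linear:
  fixes \<phi> :: "'a::real_normed_vector \<Rightarrow> real"
  assumes lin: "linear \<phi>" and le: "\<And>x. \<phi> x \<le> norm x"
  shows "bounded_linear \<phi>" "\<bar>\<phi> x\<bar> \<le> norm x"
proof -
  show *: "\<bar>\<phi> x\<bar> \<le> norm x" for x
    using le[of x] le[of "- x"] linear_neg[OF lin, of x] by simp
  show "bounded_linear \<phi>"
    by (rule bounded_linear_intro[where K = 1])
      (use * in \<open>simp_all add: linear_add[OF lin] linear_cmul[OF lin]\<close>)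
qed

corollary norming_functional:
  fixes z :: "'a::real_normed_vector"
  shows "\<exists>\<phi>. bounded_linear \<phi> \<and> (\<forall>x. \<bar>\<phi> x\<bar> \<le> norm x) \<and> \<phi> z = norm z"
proof -
  have "sublinear (norm :: 'a \<Rightarrow> real)"
    by (simp add: sublinear_def norm_triangle_ineq)
  then obtain \<phi> :: "'a \<Rightarrow> real" where "linear \<phi>" "\<And>x. \<phi> x \<le> norm x" "\<phi> z = norm z"
    using Hahn_Banach_support by blast
  then show ?thesis
    using linear_le_norm_imp_bounded_linear by blast
qed

text \<open>The distance to \<open>S\<close> is sublinear because \<open>S\<close> is a subspace,
  vanishes on \<open>S\<close>, and is positive at \<open>z\<close> because \<open>S\<close> is
  closed. A functional supporting it at \<open>z\<close> is the required one.\<close>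

corollary annihilating_functional:
  fixes S :: "'a::real_normed_vector set"
  assumes S: "subspace S" "closed S" and z: "z \<notin> S"
  obtains \<phi> :: "'a \<Rightarrow> real"
  where "bounded_linear \<phi>" "\<And>x. x \<in> S \<Longrightarrow> \<phi> x = 0" "\<phi> z \<noteq> 0"
proof -
  define p where "p x = infdist x S" for x
  have ne: "S \<noteq> {}" and 0: "0 \<in> S" using S subspace_0 by auto
  have le: "p x \<le> norm (x - s)" if "s \<in> S" for x s
    using infdist_le[OF that, of x] by (simp add: p_def dist_norm)
  have ge: "m \<le> p x" if "\<And>s. s \<in> S \<Longrightarrow> m \<le> norm (x - s)" for m x
    unfolding p_def infdist_notempty[OF ne] using ne that
    by (intro cINF_greatest) (auto simp: dist_norm)
  have "sublinear p"
  proof (rule sublinearI)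
    fix x y
    have *: "p (x + y) \<le> norm (x - s) + norm (y - t)" if "s \<in> S" "t \<in> S" for s t
    proof -
      have "p (x + y) \<le> norm ((x - s) + (y - t))"
        using le[OF subspace_add[OF S(1) that], of "x + y"] by (simp add: algebra_simps)
      then show ?thesis using norm_triangle_ineq order_trans by blast
    qed
    have "p (x + y) - norm (y - t) \<le> p x" if "t \<in> S" for t
      by (rule ge) (use * that in \<open>force simp: algebra_simps\<close>)
    then have "p (x + y) - p x \<le> p y"
      by (intro ge) (force simp: algebra_simps)
    then show "p (x + y) \<le> p x + p y" by simp
  next
    fix c :: real and x assume c: "c > 0"
    have "inverse c * p (c *\<^sub>R x) \<le> p x"
    proof (rule ge)
      fix s assume "s \<in> S"
      then have "p (c *\<^sub>R x) \<le> norm (c *\<^sub>R (x - s))"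
        using le[OF subspace_scale[OF S(1)], of s "c *\<^sub>R x" c] by (simp add: algebra_simps)
      then show "inverse c * p (c *\<^sub>R x) \<le> norm (x - s)"
        unfolding norm_scaleR using c by (simp add: field_simps)
    qed
    then show "p (c *\<^sub>R x) \<le> c * p x" using c by (simp add: field_simps)
  qed
  then obtain \<phi> where \<phi>: "linear \<phi>" "\<And>x. \<phi> x \<le> p x" "\<phi> z = p z"
    using Hahn_Banach_support by blast
  have "\<phi> x \<le> norm x" for x using \<phi>(2)[of x] le[OF 0, of x] by simp
  then have "bounded_linear \<phi>" using \<phi>(1) linear_le_norm_imp_bounded_linear(1) by blast
  \<comment> \<open>Both \<open>x\<close> and \<open>- x\<close> have distance 0 from
    \<open>S\<close>, so \<open>\<phi>\<close> is at most 0 at both.\<close>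
  moreover have "\<phi> x = 0" if "x \<in> S" for x
    using \<phi>(2)[of x] \<phi>(2)[of "- x"] le[OF that, of x] le[OF subspace_neg[OF S(1) that], of "- x"]
      linear_neg[OF \<phi>(1), of x] by simp
  moreover have "\<phi> z \<noteq> 0"
    using \<phi>(3) z S(2) ne in_closed_iff_infdist_zero[of S z] by (simp add: p_def)
  ultimately show ?thesis using that by blast
qed

section \<open>Weak compactness\<close>

lemma openin_weak_vimage:
  fixes \<phi> :: "'a::real_normed_vector \<Rightarrow> real"
  assumes "bounded_linear \<phi>" "open U"
  shows "openin weak_topology (\<phi> -` U)"
  unfolding weak_topology_def using assms by (intro topology_generated_by_Basis) auto

lemma continuous_map_weak_topology:
  fixes \<phi> :: "'a::real_normed_vector \<Rightarrow> real"
  assumes "bounded_linear \<phi>"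
  shows "continuous_map weak_topology euclideanreal \<phi>"
  using openin_weak_vimage[OF assms] by (auto simp: continuous_map_def vimage_def)

text \<open>A functional norming \<open>x - y\<close> separates the points, and disjoint
  neighbourhoods of its two values pull back.\<close>

lemma Hausdorff_space_weak_topology:
  "Hausdorff_space (weak_topology :: 'a::real_normed_vector topology)"
  unfolding Hausdorff_space_def
proof (intro allI impI)
  fix x y :: 'a
  assume xy: "x \<in> topspace weak_topology \<and> y \<in> topspace weak_topology \<and> x \<noteq> y"
  obtain \<phi> :: "'a \<Rightarrow> real" where \<phi>: "bounded_linear \<phi>" "\<phi> (x - y) = norm (x - y)"
    using norming_functional[of "x - y"] by blast
  then have "\<phi> x - \<phi> y = norm (x - y)"
    using linear_diff[OF bounded_linear.linear[OF \<phi>(1)], of x y] by simp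
  moreover have "norm (x - y) \<noteq> 0" using xy by simp
  ultimately have ne: "\<phi> x \<noteq> \<phi> y" by linarith
  obtain U V where UV: "open U" "open V" "\<phi> x \<in> U" "\<phi> y \<in> V" "U \<inter> V = {}"
    using hausdorff[OF ne] by blast
  show "\<exists>U V. openin weak_topology U \<and> openin weak_topology V \<and> x \<in> U \<and> y \<in> V \<and> disjnt U V"
    by (intro exI[of _ "\<phi> -` U"] exI[of _ "\<phi> -` V"])
      (use UV \<phi> in \<open>auto simp: openin_weak_vimage disjnt_def\<close>)
qed

text \<open>Mazur's theorem for subspaces: a functional that annihilates \<open>S\<close> but not
  \<open>z\<close> defines a weak neighbourhood of \<open>z\<close> missing
  \<open>S\<close>.\<close>

lemma closedin_weak_topology_subspace:
  assumes "subspace S" "closed S"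
  shows "closedin weak_topology S"
  unfolding closedin_def topspace_weak_topology
proof (intro conjI)
  show "openin weak_topology (UNIV - S)"
  proof (subst openin_subopen, intro ballI)
    fix z assume "z \<in> UNIV - S"
    then obtain \<phi> where \<phi>: "bounded_linear \<phi>" "\<And>x. x \<in> S \<Longrightarrow> \<phi> x = 0" "\<phi> z \<noteq> (0::real)"
      using annihilating_functional[OF assms, of z] by blast
    then show "\<exists>V. openin weak_topology V \<and> z \<in> V \<and> V \<subseteq> UNIV - S"
      by (intro exI[of _ "\<phi> -` (- {0})"] conjI openin_weak_vimage) auto
  qed
qed simp

section \<open>Weak sequential compactness\<close>

text \<open>Otherwise each point of \<open>K\<close> has a neighbourhood that the sequence
  eventually avoids; finitely many of them cover \<open>K\<close>, so late terms would lie outside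
  \<open>K\<close>.\<close>

lemma compactin_cluster_point:
  assumes K: "compactin X K" and a: "\<And>n::nat. a n \<in> K"
  obtains l where "l \<in> K" "\<And>U. openin X U \<Longrightarrow> l \<in> U \<Longrightarrow> \<exists>\<^sub>F n in sequentially. a n \<in> U"
proof (rule ccontr)
  assume "\<not> thesis"
  then have "\<forall>l\<in>K. \<exists>U. openin X U \<and> l \<in> U \<and> (\<forall>\<^sub>F n in sequentially. a n \<notin> U)"
    using that unfolding frequently_def by blast
  then obtain U where U: "\<And>l. l \<in> K \<Longrightarrow> openin X (U l) \<and> l \<in> U l \<and> (\<forall>\<^sub>F n in sequentially. a n \<notin> U l)"
    by metis
  have "(\<forall>V\<in>U ` K. openin X V) \<and> K \<subseteq> \<Union> (U ` K)" using U by blast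
  then obtain \<F> where F: "finite \<F>" "\<F> \<subseteq> U ` K" "K \<subseteq> \<Union>\<F>"
    using K unfolding compactin_def by meson
  have "\<forall>\<^sub>F n in sequentially. \<forall>V\<in>\<F>. a n \<notin> V"
    using F U by (intro eventually_ball_finite) auto
  then obtain n where "\<forall>V\<in>\<F>. a n \<notin> V" unfolding eventually_sequentially by auto
  with a[of n] F(3) show False by blast
qed

lemma cluster_point_functional:
  fixes \<phi> :: "'a::real_normed_vector \<Rightarrow> real"
  assumes l: "\<And>U. openin weak_topology U \<Longrightarrow> l \<in> U \<Longrightarrow> \<exists>\<^sub>F n in sequentially. a n \<in> U"
    and \<phi>: "bounded_linear \<phi>" and lim: "(\<lambda>n. \<phi> (a n)) \<longlonglongrightarrow> c"
  shows "\<phi> l = c"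
proof (rule ccontr)
  assume ne: "\<phi> l \<noteq> c"
  obtain U V where UV: "open U" "open V" "\<phi> l \<in> U" "c \<in> V" "U \<inter> V = {}"
    using hausdorff[OF ne] by blast
  have "\<exists>\<^sub>F n in sequentially. a n \<in> \<phi> -` U"
    by (rule l) (use UV openin_weak_vimage[OF \<phi>] in auto)
  moreover have "\<forall>\<^sub>F n in sequentially. a n \<notin> \<phi> -` U"
    using topological_tendstoD[OF lim UV(2,4)] by (rule eventually_mono) (use UV(5) in auto)
  ultimately show False by (simp add: frequently_def)
qed

text \<open>Replaces the space by a separable closed subspace containing the sequence, so that
  countably many functionals suffice. The dense set consists of the finite rational combinations of
  the terms.\<close>

lemma countable_dense_subspace:
  fixes a :: "nat \<Rightarrow> 'a::real_normed_vector"
  obtains d :: "nat \<Rightarrow> 'a"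
  where "subspace (closure (range d))" "range a \<subseteq> range d"
proof -
  \<comment> \<open>Coding combinations as lists makes their set countable, and concatenation turns
    into addition.\<close>
  define g :: "(rat \<times> nat) list \<Rightarrow> 'a"
    where "g l = (\<Sum>(q, n)\<leftarrow>l. of_rat q *\<^sub>R a n)" for l
  have g_append: "g (l @ m) = g l + g m" for l m by (simp add: g_def)
  have g_scale: "of_rat q *\<^sub>R g l = g (map (\<lambda>(p, n). (q * p, n)) l)" for q l
    by (induction l) (auto simp: g_def scaleR_right_distrib of_rat_mult)
  let ?C = "closure (range g)"
  have add: "x + y \<in> ?C" if "x \<in> ?C" "y \<in> ?C" for x y
  proof -
    obtain f h where "\<And>n. f n \<in> range g" "f \<longlonglongrightarrow> x" "\<And>n. h n \<in> range g" "h \<longlonglongrightarrow> y"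
      using \<open>x \<in> ?C\<close> \<open>y \<in> ?C\<close> unfolding closure_sequential by blast
    moreover from this have "f n + h n \<in> range g" for n
      by (metis g_append imageE rangeI)
    ultimately show ?thesis unfolding closure_sequential
      by (intro exI[of _ "\<lambda>n. f n + h n"]) (auto intro: tendsto_add)
  qed
  have scale_rat: "of_rat q *\<^sub>R x \<in> ?C" if "x \<in> ?C" for x q
  proof -
    obtain f where "\<And>n. f n \<in> range g" "f \<longlonglongrightarrow> x"
      using \<open>x \<in> ?C\<close> unfolding closure_sequential by blast
    moreover from this have "of_rat q *\<^sub>R f n \<in> range g" for n
      by (metis g_scale imageE rangeI)
    ultimately show ?thesis unfolding closure_sequential
      by (intro exI[of _ "\<lambda>n. of_rat q *\<^sub>R f n"]) (auto intro: tendsto_intros)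
  qed
  have scale: "c *\<^sub>R x \<in> ?C" if "x \<in> ?C" for x c
  proof -
    \<comment> \<open>The admissible scalars form a closed set containing the rationals, hence are
      all reals.\<close>
    have "closed ((\<lambda>c. c *\<^sub>R x) -` ?C)"
      by (intro closed_vimage) (auto intro!: continuous_intros)
    moreover have "\<rat> \<subseteq> (\<lambda>c. c *\<^sub>R x) -` ?C"
      using scale_rat[OF that] by (auto elim!: Rats_cases)
    ultimately have "closure \<rat> \<subseteq> (\<lambda>c. c *\<^sub>R x) -` ?C" by (intro closure_minimal)
    then show ?thesis by (auto simp: Rats_closure_real)
  qed
  have "0 \<in> ?C"
    using closure_subset rangeI[of g "[]"] by (fastforce simp: g_def)
  with add scale have sub: "subspace ?C" by (simp add: subspace_def)
  have "range (from_nat_into (range g)) = range g"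
    by (rule range_from_nat_into) auto
  moreover have "a n \<in> range g" for n
    by (rule range_eqI[of _ _ "[(1, n)]"]) (simp add: g_def)
  ultimately show ?thesis using sub by (intro that[of "from_nat_into (range g)"]) auto
qed

text \<open>If \<open>z\<close> is nonzero, some \<open>d k\<close> is closer to it than half its
  norm. Then \<open>norm (d k)\<close>, being \<open>\<phi> k (d k - z)\<close>, is less than half
  of \<open>norm z\<close>, against the triangle inequality.\<close>

lemma norming_functionals_separate:
  fixes d :: "nat \<Rightarrow> 'a::real_normed_vector" and \<phi> :: "nat \<Rightarrow> 'a \<Rightarrow> real"
  assumes \<phi>: "\<And>k. bounded_linear (\<phi> k)" "\<And>k x. \<bar>\<phi> k x\<bar> \<le> norm x" "\<And>k. \<phi> k (d k) = norm (d k)"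
    and z: "z \<in> closure (range d)" "\<And>k. \<phi> k z = 0"
  shows "z = 0"
proof (rule ccontr)
  assume "z \<noteq> 0"
  then have "norm z / 2 > 0" by simp
  then obtain k where k: "dist (d k) z < norm z / 2"
    using z(1) unfolding closure_approachable by blast
  have "norm (d k) = \<phi> k (d k - z)"
    using linear_diff[OF bounded_linear.linear[OF \<phi>(1)]] \<phi>(3) z(2) by simp
  also have "\<dots> \<le> dist (d k) z" using \<phi>(2)[of k "d k - z"] by (simp add: dist_norm)
  finally show False
    using k norm_triangle_ineq2[of z "d k"] by (simp add: dist_norm norm_minus_commute)
qed

text \<open>The countably many norming functionals all converge along some subsequence. Their limits
  determine its cluster points uniquely inside the separable subspace, and a sequence all of whose
  subsequences cluster at the same point converges to it.\<close>

theorem weakly_compactin_imp_convergent_subsequence: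
  fixes a :: "nat \<Rightarrow> 'a::real_normed_vector"
  assumes K: "compactin weak_topology K" and a: "\<And>n. a n \<in> K"
  obtains l r where "l \<in> K" "strict_mono r" "limitin weak_topology (a \<circ> r) l sequentially"
proof -
  obtain d :: "nat \<Rightarrow> 'a" where d: "subspace (closure (range d))" "range a \<subseteq> range d"
    by (rule countable_dense_subspace)
  have "\<forall>k. \<exists>\<phi>::'a \<Rightarrow> real. bounded_linear \<phi> \<and> (\<forall>x. \<bar>\<phi> x\<bar> \<le> norm x) \<and> \<phi> (d k) = norm (d k)"
    using norming_functional by metis
  then obtain \<phi> :: "nat \<Rightarrow> 'a \<Rightarrow> real" where
    \<phi>: "\<And>k. bounded_linear (\<phi> k)" "\<And>k x. \<bar>\<phi> k x\<bar> \<le> norm x" "\<And>k. \<phi> k (d k) = norm (d k)"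
    by metis
  define \<Phi> where "\<Phi> x k = \<phi> k x" for x k
  have "continuous_map weak_topology euclidean \<Phi>"
    unfolding euclidean_product_topology[symmetric] continuous_map_componentwise_UNIV
    by (simp add: \<Phi>_def continuous_map_weak_topology[OF \<phi>(1)])
  then have "compact (\<Phi> ` K)"
    using image_compactin[OF K, of euclidean \<Phi>] by simp
  \<comment> \<open>The target is a countable product of real lines, where compactness implies
    sequential compactness.\<close>
  then have "seq_compact (\<Phi> ` K)" by (rule compact_imp_seq_compact)
  then obtain C r where r: "strict_mono r" "(\<lambda>n. \<Phi> (a (r n))) \<longlonglongrightarrow> C"
    unfolding seq_compact_def comp_def using a by (elim allE[of _ "\<lambda>n. \<Phi> (a n)"]) auto
  define b where "b = a \<circ> r"
  have lim: "(\<lambda>n. \<phi> k (b n)) \<longlonglongrightarrow> C k" for k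
    using r(2) continuous_on_tendsto_compose[OF continuous_on_product_coordinates[of k] r(2)]
    by (auto simp: b_def \<Phi>_def)
  have cl: "closedin weak_topology (closure (range d))"
    using d(1) by (intro closedin_weak_topology_subspace) auto
  have b: "b n \<in> K" "b n \<in> closure (range d)" for n
    using a d(2) closure_subset[of "range d"] by (auto simp: b_def)
  have cluster: "\<exists>l\<in>K. l \<in> closure (range d) \<and> (\<forall>k. \<phi> k l = C k) \<and>
      (\<forall>U. openin weak_topology U \<longrightarrow> l \<in> U \<longrightarrow> (\<exists>\<^sub>F n in sequentially. b (s n) \<in> U))"
    if s: "strict_mono s" for s
  proof -
    obtain l where l: "l \<in> K"
      "\<And>U. openin weak_topology U \<Longrightarrow> l \<in> U \<Longrightarrow> \<exists>\<^sub>F n in sequentially. b (s n) \<in> U"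
      using compactin_cluster_point[OF K, of "\<lambda>n. b (s n)"] b by blast
    have "l \<in> closure (range d)"
    proof (rule ccontr)
      assume "l \<notin> closure (range d)"
      then have "\<exists>\<^sub>F n in sequentially. b (s n) \<in> UNIV - closure (range d)"
        using cl by (intro l(2)) (auto simp: closedin_def)
      then show False using b(2) by (auto simp: frequently_def)
    qed
    moreover have "\<phi> k l = C k" for k
      by (rule cluster_point_functional[OF l(2) \<phi>(1)])
        (use LIMSEQ_subseq_LIMSEQ[OF lim s] in \<open>auto simp: comp_def\<close>)
    ultimately show ?thesis using l by blast
  qed
  obtain l where l: "l \<in> K" "l \<in> closure (range d)" "\<And>k. \<phi> k l = C k"
    using cluster[of id] by (auto simp: strict_mono_def)
  have "limitin weak_topology b l sequentially"
    unfolding limitin_def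
  proof (intro conjI allI impI; (elim conjE)?)
    fix U assume U: "openin weak_topology U" "l \<in> U"
    show "\<forall>\<^sub>F n in sequentially. b n \<in> U"
    proof (rule ccontr)
      assume "\<not> ?thesis"
      \<comment> \<open>A subsequence staying outside \<open>U\<close> still has a cluster point,
        which must be \<open>l\<close>.\<close>
      then obtain s :: "nat \<Rightarrow> nat" where s: "strict_mono s" "\<And>n. b (s n) \<notin> U"
        using not_eventually_sequentiallyD by blast
      obtain m where m: "m \<in> closure (range d)" "\<And>k. \<phi> k m = C k"
        "\<And>U. openin weak_topology U \<Longrightarrow> m \<in> U \<Longrightarrow> \<exists>\<^sub>F n in sequentially. b (s n) \<in> U"
        using cluster[OF s(1)] by blast
      have "m - l = 0"
        by (rule norming_functionals_separate[OF \<phi>])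
          (use l m subspace_diff[OF d(1)] in \<open>auto simp: linear_diff[OF bounded_linear.linear[OF \<phi>(1)]]\<close>)
      then have "\<exists>\<^sub>F n in sequentially. b (s n) \<in> U" using m(3) U by simp
      with s(2) show False by (auto simp: frequently_def)
    qed
  qed simp
  with l(1) r(1) that show ?thesis by (simp add: b_def)
qed

text \<open>Complete continuity makes the images of a weakly convergent subsequence norm convergent;
  weak continuity of \<open>T\<close> identifies the limit as \<open>T l\<close>, which lies in the
  image.\<close>

lemma completely_continuous_compact_image:
  fixes T :: "'b::real_normed_vector \<Rightarrow> 'a::real_normed_vector"
  assumes T: "bounded_linear T" and cc: "completely_continuous T"
    and K: "compactin weak_topology K"
  shows "compact (T ` K)"
  unfolding compact_eq_seq_compact_metric seq_compact_def
proof (intro allI impI)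
  fix f assume "\<forall>n::nat. f n \<in> T ` K"
  then have "\<forall>n. \<exists>x. x \<in> K \<and> f n = T x" by blast
  then obtain a where a: "\<And>n. a n \<in> K" "\<And>n. f n = T (a n)" by metis
  obtain l r where r: "l \<in> K" "strict_mono r" "limitin weak_topology (a \<circ> r) l sequentially"
    using weakly_compactin_imp_convergent_subsequence[OF K a(1)] .
  then have "convergent (\<lambda>n. T ((a \<circ> r) n))" using cc unfolding completely_continuous_def by blast
  then obtain x where x: "(\<lambda>n. T (a (r n))) \<longlonglongrightarrow> x" by (auto simp: convergent_def)
  have "limitin weak_topology (\<lambda>n. T (a (r n))) x sequentially"
    unfolding limitin_weak_topology_iff by (intro allI impI bounded_linear.tendsto[OF _ x])
  moreover have "limitin weak_topology (\<lambda>n. T (a (r n))) (T l) sequentially"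
    unfolding limitin_weak_topology_iff
  proof (intro allI impI)
    fix \<phi> :: "'a \<Rightarrow> real" assume "bounded_linear \<phi>"
    then have "bounded_linear (\<lambda>x. \<phi> (T x))" by (rule bounded_linear_compose[OF _ T])
    with r(3) have "(\<lambda>n. \<phi> (T ((a \<circ> r) n))) \<longlonglongrightarrow> \<phi> (T l)"
      unfolding limitin_weak_topology_iff by blast
    then show "(\<lambda>n. \<phi> (T (a (r n)))) \<longlonglongrightarrow> \<phi> (T l)" by simp
  qed
  ultimately have "x = T l"
    by (rule limitin_Hausdorff_unique) (simp_all add: Hausdorff_space_weak_topology)
  then show "\<exists>l\<in>T ` K. \<exists>r. strict_mono r \<and> (f \<circ> r) \<longlonglongrightarrow> l"
    using r(1,2) x by (intro bexI[of _ "T l"] exI[of _ r]) (simp_all add: a(2) comp_def)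
qed

section \<open>Differentiability along families of sets\<close>

text \<open>Replaces the extended real supremum by a uniform epsilon bound. Over the empty set the
  supremum would be -\<infinity>, not 0.\<close>

lemma tendsto_SUP_abs_iff:
  fixes g :: "'c \<Rightarrow> 'b \<Rightarrow> real"
  assumes A: "A \<noteq> {}"
  shows "((\<lambda>t. SUP u\<in>A. ereal \<bar>g t u\<bar>) \<longlongrightarrow> 0) F \<longleftrightarrow>
    (\<forall>e>0. \<forall>\<^sub>F t in F. \<forall>u\<in>A. \<bar>g t u\<bar> \<le> e)"
proof
  assume L: "((\<lambda>t. SUP u\<in>A. ereal \<bar>g t u\<bar>) \<longlongrightarrow> 0) F"
  show "\<forall>e>0. \<forall>\<^sub>F t in F. \<forall>u\<in>A. \<bar>g t u\<bar> \<le> e"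
  proof (intro allI impI)
    fix e :: real assume "e > 0"
    then have "\<forall>\<^sub>F t in F. (SUP u\<in>A. ereal \<bar>g t u\<bar>) < ereal e"
      by (intro order_tendstoD(2)[OF L]) simp
    then show "\<forall>\<^sub>F t in F. \<forall>u\<in>A. \<bar>g t u\<bar> \<le> e"
    proof (rule eventually_mono, intro ballI)
      fix t u assume "(SUP u\<in>A. ereal \<bar>g t u\<bar>) < ereal e" "u \<in> A"
      then have "ereal \<bar>g t u\<bar> < ereal e" by (rule le_less_trans[OF SUP_upper, rotated])
      then show "\<bar>g t u\<bar> \<le> e" by simp
    qed
  qed
next
  assume R: "\<forall>e>0. \<forall>\<^sub>F t in F. \<forall>u\<in>A. \<bar>g t u\<bar> \<le> e"
  have nonneg: "0 \<le> (SUP u\<in>A. ereal \<bar>g t u\<bar>)" for t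
    using A by (meson SUP_upper2 abs_ge_zero ereal_less_eq(5) ex_in_conv)
  show "((\<lambda>t. SUP u\<in>A. ereal \<bar>g t u\<bar>) \<longlongrightarrow> 0) F"
  proof (rule order_tendstoI)
    fix a :: ereal assume "a < 0"
    then show "\<forall>\<^sub>F t in F. a < (SUP u\<in>A. ereal \<bar>g t u\<bar>)"
      using nonneg less_le_trans by (intro always_eventually) blast
  next
    fix a :: ereal assume "0 < a"
    \<comment> \<open>A real number below \<open>a\<close> is chosen because \<open>a\<close> may be
      infinite.\<close>
    then obtain e where e: "0 < ereal e" "ereal e < a" using ereal_dense2 by blast
    then have "\<forall>\<^sub>F t in F. \<forall>u\<in>A. \<bar>g t u\<bar> \<le> e" using R by simp
    then show "\<forall>\<^sub>F t in F. (SUP u\<in>A. ereal \<bar>g t u\<bar>) < a"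
    proof (rule eventually_mono)
      fix t assume "\<forall>u\<in>A. \<bar>g t u\<bar> \<le> e"
      then have "(SUP u\<in>A. ereal \<bar>g t u\<bar>) \<le> ereal e" by (intro SUP_least) simp
      with e show "(SUP u\<in>A. ereal \<bar>g t u\<bar>) < a" by simp
    qed
  qed
qed

definition uniform_derivative_on ::
    "'a set \<Rightarrow> ('a::real_normed_vector \<Rightarrow> real) \<Rightarrow> 'a \<Rightarrow> ('a \<Rightarrow> real) \<Rightarrow> bool" where
  "uniform_derivative_on A f x D \<longleftrightarrow>
    (\<forall>e>0. \<forall>\<^sub>F t in at 0. \<forall>u\<in>A. \<bar>(f (x + t *\<^sub>R u) - f x) / t - D u\<bar> \<le> e)"

lemma uniform_derivative_on_subset:
  assumes "uniform_derivative_on B f x D" "A \<subseteq> B"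
  shows "uniform_derivative_on A f x D"
  unfolding uniform_derivative_on_def
proof (intro allI impI)
  fix e :: real assume "e > 0"
  then have "\<forall>\<^sub>F t in at 0. \<forall>u\<in>B. \<bar>(f (x + t *\<^sub>R u) - f x) / t - D u\<bar> \<le> e"
    using assms(1) by (simp add: uniform_derivative_on_def)
  then show "\<forall>\<^sub>F t in at 0. \<forall>u\<in>A. \<bar>(f (x + t *\<^sub>R u) - f x) / t - D u\<bar> \<le> e"
    by (rule eventually_mono) (use assms(2) in blast)
qed

lemma beta_differentiable_at_iff:
  assumes "{} \<notin> \<beta>"
  shows "beta_differentiable_at \<beta> f x \<longleftrightarrow>
    (\<exists>D. bounded_linear D \<and> (\<forall>A\<in>\<beta>. uniform_derivative_on A f x D))"
proof -
  have "((\<lambda>t. SUP u\<in>A. ereal \<bar>(f (x + t *\<^sub>R u) - f x) / t - D u\<bar>) \<longlongrightarrow> 0) (at (0::real)) \<longleftrightarrow>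
      uniform_derivative_on A f x D" if "A \<in> \<beta>" for A D
    unfolding uniform_derivative_on_def using that assms by (intro tendsto_SUP_abs_iff) auto
  then show ?thesis by (simp add: beta_differentiable_at_def cong: conj_cong)
qed

lemma gateaux_differentiable_at_iff:
  "gateaux_differentiable_at f x \<longleftrightarrow>
    (\<exists>D. bounded_linear D \<and> (\<forall>A. A \<noteq> {} \<and> finite A \<longrightarrow> uniform_derivative_on A f x D))"
  unfolding gateaux_differentiable_at_def by (subst beta_differentiable_at_iff) auto

lemma hadamard_differentiable_at_iff:
  "hadamard_differentiable_at f x \<longleftrightarrow>
    (\<exists>D. bounded_linear D \<and>
      (\<forall>A. A \<noteq> {} \<and> compact (closure A) \<longrightarrow> uniform_derivative_on A f x D))"
  unfolding hadamard_differentiable_at_def by (subst beta_differentiable_at_iff) auto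

lemma weak_hadamard_differentiable_at_iff:
  "weak_hadamard_differentiable_at f x \<longleftrightarrow>
    (\<exists>D. bounded_linear D \<and>
      (\<forall>A. A \<noteq> {} \<and> compactin weak_topology (weak_topology closure_of A) \<longrightarrow>
        uniform_derivative_on A f x D))"
  unfolding weak_hadamard_differentiable_at_def by (subst beta_differentiable_at_iff) auto

section \<open>Lipschitz functions and compact sets of directions\<close>

text \<open>The quotients are \<open>L\<close>-Lipschitz in the direction, uniformly in
  \<open>t\<close>, and \<open>D\<close> is Lipschitz too, so convergence on a finite net controls
  convergence on \<open>K\<close>.\<close>

lemma lipschitz_uniform_derivative_on_compact:
  assumes f: "L-lipschitz_on UNIV f" and D: "bounded_linear D"
    and gat: "\<And>u. uniform_derivative_on {u} f x D"
    and K: "compact K"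
  shows "uniform_derivative_on K f x D"
  unfolding uniform_derivative_on_def
proof (intro allI impI)
  fix e :: real assume e: "e > 0"
  have L: "L \<ge> 0" using f by (rule lipschitz_on_nonneg)
  obtain B where B: "B > 0" "\<And>v. norm (D v) \<le> norm v * B"
    using bounded_linear.pos_bounded[OF D] by blast
  \<comment> \<open>With this mesh, moving a direction to the net costs at most e / 2 in quotient
    and derivative together; the net points use the other half.\<close>
  define d where "d = e / (2 * (L + B))"
  have d: "d > 0" "(L + B) * d = e / 2" using e L B(1) by (simp_all add: d_def field_simps)
  obtain k where k: "finite k" "K \<subseteq> (\<Union>v\<in>k. ball v d)"
    using seq_compact_imp_totally_bounded[OF compact_imp_seq_compact[OF K]] d(1) by blast
  let ?q = "\<lambda>t u. (f (x + t *\<^sub>R u) - f x) / t"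
  have "\<forall>\<^sub>F t in at 0. \<forall>v\<in>k. \<bar>?q t v - D v\<bar> \<le> e / 2"
  proof (intro eventually_ball_finite ballI)
    fix v
    show "\<forall>\<^sub>F t in at 0. \<bar>?q t v - D v\<bar> \<le> e / 2"
      using gat[of v, unfolded uniform_derivative_on_def, rule_format, of "e / 2"] e by simp
  qed (rule k(1))
  moreover have "\<forall>\<^sub>F t in at 0. t \<noteq> (0::real)" by (rule eventually_neq_at_within)
  ultimately show "\<forall>\<^sub>F t in at 0. \<forall>u\<in>K. \<bar>?q t u - D u\<bar> \<le> e"
  proof eventually_elim
    fix t :: real assume t: "\<forall>v\<in>k. \<bar>?q t v - D v\<bar> \<le> e / 2" "t \<noteq> 0"
    show "\<forall>u\<in>K. \<bar>?q t u - D u\<bar> \<le> e"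
    proof
      fix u assume "u \<in> K"
      then obtain v where v: "v \<in> k" "norm (u - v) < d"
        using k(2) by (auto simp: dist_norm norm_minus_commute)
      have "\<bar>f (x + t *\<^sub>R u) - f (x + t *\<^sub>R v)\<bar> \<le> L * norm (t *\<^sub>R (u - v))"
        using lipschitz_onD[OF f, of "x + t *\<^sub>R u" "x + t *\<^sub>R v"]
        by (simp add: dist_norm scaleR_diff_right)
      then have "\<bar>?q t u - ?q t v\<bar> \<le> L * norm (u - v)"
        using t(2) by (simp add: diff_divide_distrib[symmetric] divide_le_eq mult.commute mult.left_commute)
      moreover have "\<bar>D u - D v\<bar> \<le> B * norm (u - v)"
        using B(2)[of "u - v"] linear_diff[OF bounded_linear.linear[OF D], of u v]
        by (simp add: mult.commute)
      moreover have "(L + B) * norm (u - v) \<le> (L + B) * d"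
        using v(2) L B(1) by (intro mult_left_mono) auto
      then have "L * norm (u - v) + B * norm (u - v) \<le> e / 2"
        using d(2) by (simp add: algebra_simps)
      moreover have "\<bar>?q t v - D v\<bar> \<le> e / 2" using t(1) v(1) by blast
      moreover have "\<bar>a - c\<bar> \<le> e"
        if "\<bar>a - b\<bar> \<le> p" "\<bar>c - d\<bar> \<le> q" "p + q \<le> e / 2" "\<bar>b - d\<bar> \<le> e / 2" for a b c d p q
        using that by linarith
      ultimately show "\<bar>?q t u - D u\<bar> \<le> e" by blast
    qed
  qed
qed

lemma lipschitz_gateaux_uniform_on_compact:
  assumes "L-lipschitz_on UNIV f" "gateaux_differentiable_at f x"
  shows "\<exists>D. bounded_linear D \<and> (\<forall>K. compact K \<longrightarrow> uniform_derivative_on K f x D)"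
proof -
  obtain D where D: "bounded_linear D" "\<And>A. A \<noteq> {} \<Longrightarrow> finite A \<Longrightarrow> uniform_derivative_on A f x D"
    using assms(2) unfolding gateaux_differentiable_at_iff by blast
  have "uniform_derivative_on {u} f x D" for u by (rule D(2)) auto
  then show ?thesis
    using lipschitz_uniform_derivative_on_compact[OF assms(1) D(1)] D(1) by blast
qed

text \<open>Uniformity on the compact closure passes to the set itself; conversely, finite sets are
  compact.\<close>

lemma lipschitz_gateaux_iff_hadamard:
  fixes f :: "'a::real_normed_vector \<Rightarrow> real"
  assumes "L-lipschitz_on UNIV f"
  shows "gateaux_differentiable_at f x \<longleftrightarrow> hadamard_differentiable_at f x"
proof
  assume "gateaux_differentiable_at f x"
  then obtain D where D: "bounded_linear D" "\<And>K. compact K \<Longrightarrow> uniform_derivative_on K f x D"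
    using lipschitz_gateaux_uniform_on_compact[OF assms] by blast
  have "uniform_derivative_on A f x D" if "compact (closure A)" for A
    by (rule uniform_derivative_on_subset[OF D(2)[OF that] closure_subset])
  with D(1) show "hadamard_differentiable_at f x"
    unfolding hadamard_differentiable_at_iff by blast
next
  assume "hadamard_differentiable_at f x"
  moreover have "compact (closure A)" if "finite A" for A :: "'a set"
    using that by (simp add: closure_closed finite_imp_closed finite_imp_compact)
  ultimately show "gateaux_differentiable_at f x"
    unfolding hadamard_differentiable_at_iff gateaux_differentiable_at_iff by blast
qed

lemma uniform_derivative_on_compose_linear:
  assumes T: "bounded_linear T" and D: "uniform_derivative_on (T ` A) f (T y) D"
  shows "uniform_derivative_on A (f \<circ> T) y (D \<circ> T)"
proof -
  have "T (y + t *\<^sub>R u) = T y + t *\<^sub>R T u" for t u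
    using bounded_linear.linear[OF T] by (simp add: linear_add linear_cmul)
  with D show ?thesis by (simp add: uniform_derivative_on_def)
qed

lemma completely_continuous_imp_weak_hadamard:
  assumes T: "bounded_linear T" "completely_continuous T"
    and f: "L-lipschitz_on UNIV f" "gateaux_differentiable_at f (T y)"
  shows "weak_hadamard_differentiable_at (f \<circ> T) y"
proof -
  obtain D where D: "bounded_linear D" "\<And>K. compact K \<Longrightarrow> uniform_derivative_on K f (T y) D"
    using lipschitz_gateaux_uniform_on_compact[OF f] by blast
  have "bounded_linear (D \<circ> T)"
    using bounded_linear_compose[OF D(1) T(1)] by (simp add: comp_def)
  moreover have "uniform_derivative_on A (f \<circ> T) y (D \<circ> T)"
    if "compactin weak_topology (weak_topology closure_of A)" for A
  proof (rule uniform_derivative_on_compose_linear[OF T(1)], rule uniform_derivative_on_subset)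
    show "uniform_derivative_on (T ` (weak_topology closure_of A)) f (T y) D"
      by (intro D(2) completely_continuous_compact_image[OF T that])
    show "T ` A \<subseteq> T ` (weak_topology closure_of A)"
      by (intro image_mono closure_of_subset) simp
  qed
  ultimately show ?thesis unfolding weak_hadamard_differentiable_at_iff by blast
qed

section \<open>The counterexample\<close>

text \<open>The functional norming \<open>u\<close> is eventually smaller than \<open>e\<close> at
  \<open>x n\<close>. If \<open>s *\<^sub>R u\<close> were within \<open>e\<close> of
  \<open>x n\<close>, its norm would be less than 2 e, hence \<open>norm (x n)\<close> less than 3
  e. The threshold for \<open>n\<close> depends on \<open>u\<close> but not on
  \<open>s\<close>.\<close>

lemma weakly_null_eventually_far_from_line:
  fixes x :: "nat \<Rightarrow> 'a::real_normed_vector"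
  assumes x: "limitin weak_topology x 0 sequentially" and e: "e > 0" "\<And>n. norm (x n) \<ge> 4 * e"
  shows "\<forall>\<^sub>F n in sequentially. \<forall>s. norm (s *\<^sub>R u - x n) \<ge> e"
proof -
  obtain \<phi> :: "'a \<Rightarrow> real" where \<phi>: "bounded_linear \<phi>" "\<And>x. \<bar>\<phi> x\<bar> \<le> norm x" "\<phi> u = norm u"
    using norming_functional[of u] by blast
  have lin: "linear \<phi>" using \<phi>(1) by (rule bounded_linear.linear)
  have "(\<lambda>n. \<phi> (x n)) \<longlonglongrightarrow> \<phi> 0" using x \<phi>(1) by (simp add: limitin_weak_topology_iff)
  then have "(\<lambda>n. \<phi> (x n)) \<longlonglongrightarrow> 0" by (simp add: linear_0[OF lin])
  then have "\<forall>\<^sub>F n in sequentially. \<bar>\<phi> (x n)\<bar> < e"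
    using e(1) by (auto dest: tendstoD simp: dist_real_def)
  then show ?thesis
  proof (rule eventually_mono, intro allI)
    fix n s assume n: "\<bar>\<phi> (x n)\<bar> < e"
    have "\<phi> (s *\<^sub>R u - x n) = s * norm u - \<phi> (x n)"
      using \<phi>(3) by (simp add: linear_diff[OF lin] linear_cmul[OF lin])
    then have "\<bar>s * norm u\<bar> \<le> norm (s *\<^sub>R u - x n) + \<bar>\<phi> (x n)\<bar>"
      using \<phi>(2)[of "s *\<^sub>R u - x n"] by linarith
    moreover have "norm (x n) \<le> norm (s *\<^sub>R u - x n) + \<bar>s * norm u\<bar>"
      using norm_triangle_ineq2[of "x n" "s *\<^sub>R u"] by (simp add: norm_minus_commute abs_mult)
    ultimately show "norm (s *\<^sub>R u - x n) \<ge> e" using n e by (smt (verit))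
  qed
qed

text \<open>The function is the distance to the complement of the balls of radius \<open>e / (n + 1)\<close> around
  the points \<open>x n / (n + 1)\<close>; each line through the origin meets only finitely many of these balls.\<close>

lemma lipschitz_bumps_on_weakly_null_sequence:
  fixes x :: "nat \<Rightarrow> 'a::real_normed_vector"
  assumes x: "limitin weak_topology x 0 sequentially" and e: "e > 0" "\<And>n. norm (x n) \<ge> 4 * e"
  shows "\<exists>f :: 'a \<Rightarrow> real. 1-lipschitz_on UNIV f \<and> f 0 = 0 \<and> (\<forall>u. \<forall>\<^sub>F t in at 0. f (t *\<^sub>R u) = 0) \<and>
    (\<forall>n. f (inverse (Suc n) *\<^sub>R x n) \<ge> e * inverse (Suc n))"
proof -
  define t where "t n = inverse (real (Suc n))" for n
  have t: "t n > 0" for n by (simp add: t_def)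
  define S where "S = - (\<Union>n. ball (t n *\<^sub>R x n) (e * t n))"
  have scaled: "norm (s *\<^sub>R u - t n *\<^sub>R x n) = t n * norm ((s / t n) *\<^sub>R u - x n)" for s u n
  proof -
    have "s *\<^sub>R u - t n *\<^sub>R x n = t n *\<^sub>R ((s / t n) *\<^sub>R u - x n)"
      using t[of n] by (simp add: scaleR_diff_right)
    then show ?thesis using t[of n] by simp
  qed
  have S: "v \<in> S \<longleftrightarrow> (\<forall>n. norm (v - t n *\<^sub>R x n) \<ge> e * t n)" for v
    by (auto simp: S_def dist_norm norm_minus_commute not_less)
  \<comment> \<open>Rescaling by \<open>t n\<close> turns membership in the n-th ball into closeness
    of \<open>(s / t n) *\<^sub>R u\<close> to \<open>x n\<close>, with the same radius
    \<open>e\<close> for all \<open>n\<close>.\<close>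
  have line: "s *\<^sub>R u \<in> S \<longleftrightarrow> (\<forall>n. norm ((s / t n) *\<^sub>R u - x n) \<ge> e)" for s u
    using t by (simp add: S scaled mult.commute)
  have e4: "norm (x n) \<ge> e" for n using e(1) e(2)[of n] by linarith
  have 0: "0 \<in> S" using line[of 0 0] e4 by simp
  define f where "f v = infdist v S" for v
  have "1-lipschitz_on UNIV f"
    using infdist_triangle_abs by (intro lipschitz_onI) (auto simp: f_def dist_real_def)
  moreover have "f 0 = 0" using 0 by (simp add: f_def)
  moreover have "\<forall>\<^sub>F s in at 0. f (s *\<^sub>R u) = 0" for u
  proof -
    \<comment> \<open>From \<open>N\<close> on the balls miss the line for all \<open>s\<close>. For
      the finitely many others, the rescaled point tends to 0, which is at distance more than
      \<open>e\<close> from \<open>x n\<close>.\<close>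
    obtain N where N: "\<And>n s. n \<ge> N \<Longrightarrow> norm (s *\<^sub>R u - x n) \<ge> e"
      using weakly_null_eventually_far_from_line[OF x e, of u] unfolding eventually_sequentially by blast
    have "\<forall>\<^sub>F s in at 0. \<forall>n\<in>{..<N}. norm ((s / t n) *\<^sub>R u - x n) \<ge> e"
    proof (intro eventually_ball_finite ballI)
      fix n
      have "((\<lambda>s. norm ((s / t n) *\<^sub>R u - x n)) \<longlongrightarrow> norm ((0 / t n) *\<^sub>R u - x n)) (at 0)"
        using t[of n] by (intro tendsto_intros) auto
      moreover have "e < norm ((0 / t n) *\<^sub>R u - x n)" using e(1) e(2)[of n] by simp
      ultimately have "\<forall>\<^sub>F s in at 0. e < norm ((s / t n) *\<^sub>R u - x n)" by (rule order_tendstoD(1))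
      then show "\<forall>\<^sub>F s in at 0. e \<le> norm ((s / t n) *\<^sub>R u - x n)" by (rule eventually_mono) simp
    qed simp
    then show ?thesis
    proof (rule eventually_mono)
      fix s assume "\<forall>n\<in>{..<N}. norm ((s / t n) *\<^sub>R u - x n) \<ge> e"
      then have "s *\<^sub>R u \<in> S" unfolding line using N by (meson lessThan_iff not_less)
      then show "f (s *\<^sub>R u) = 0" by (simp add: f_def)
    qed
  qed
  moreover have "f (t n *\<^sub>R x n) \<ge> e * t n" for n
  proof -
    \<comment> \<open>\<open>infdist\<close> to the empty set is 0 by convention, so the lower bound
      on the distance relies on \<open>S\<close> having a point.\<close>
    have ne: "S \<noteq> {}" using 0 by blast
    show ?thesis
      unfolding f_def infdist_notempty[OF ne] using S ne
      by (intro cINF_greatest) (auto simp: dist_norm norm_minus_commute)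
  qed
  ultimately show ?thesis unfolding t_def by (intro exI[of _ f]) blast
qed

text \<open>With the limit added the set is weakly compact, hence weakly closed by the Hausdorff
  property, so it contains the closure.\<close>

lemma relatively_weakly_compact_sequence:
  fixes z :: "nat \<Rightarrow> 'a::real_normed_vector"
  assumes z: "limitin weak_topology z l sequentially" and A: "A \<subseteq> range z"
  shows "compactin weak_topology (weak_topology closure_of A)"
proof -
  have K: "compactin weak_topology (insert l A)"
    by (rule compactin_sequence_with_limit[OF z A]) simp
  then have "closedin weak_topology (insert l A)"
    by (rule compactin_imp_closedin[OF Hausdorff_space_weak_topology])
  then have "weak_topology closure_of A \<subseteq> insert l A"
    by (intro closure_of_minimal) auto
  then show ?thesis by (rule closed_compactin[OF K]) simp
qed

text \<open>A weakly convergent sequence with divergent images has a subsequence whose images stay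
  away from the image of the weak limit; that limit is then subtracted.\<close>

lemma not_completely_continuous_weakly_null:
  fixes T :: "'b::real_normed_vector \<Rightarrow> 'a::real_normed_vector"
  assumes T: "bounded_linear T" and ncc: "\<not> completely_continuous T"
  obtains z e where "limitin weak_topology z 0 sequentially" "e > 0" "\<And>n. norm (T (z n)) \<ge> e"
proof -
  obtain y l where y: "limitin weak_topology y l sequentially" "\<not> convergent (\<lambda>n. T (y n))"
    using ncc unfolding completely_continuous_def by blast
  then have "\<not> (\<lambda>n. T (y n)) \<longlonglongrightarrow> T l" unfolding convergent_def by blast
  then obtain e where e: "e > 0" "\<not> (\<forall>\<^sub>F n in sequentially. dist (T (y n)) (T l) < e)"
    unfolding tendsto_iff by blast
  then obtain r :: "nat \<Rightarrow> nat" where r: "strict_mono r" "\<And>n. \<not> dist (T (y (r n))) (T l) < e"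
    using not_eventually_sequentiallyD[OF e(2)] by blast
  have yr: "limitin weak_topology (y \<circ> r) l sequentially" by (rule limitin_subsequence[OF r(1) y(1)])
  show ?thesis
  proof
    show "limitin weak_topology (\<lambda>n. y (r n) - l) 0 sequentially"
      unfolding limitin_weak_topology_iff
    proof (intro allI impI)
      fix \<phi> :: "'b \<Rightarrow> real" assume \<phi>: "bounded_linear \<phi>"
      have lin: "linear \<phi>" using \<phi> by (rule bounded_linear.linear)
      have "(\<lambda>n. \<phi> ((y \<circ> r) n)) \<longlonglongrightarrow> \<phi> l"
        using yr \<phi> unfolding limitin_weak_topology_iff by blast
      then have "(\<lambda>n. \<phi> (y (r n)) - \<phi> l) \<longlonglongrightarrow> \<phi> l - \<phi> l" by (intro tendsto_intros) simp
      then show "(\<lambda>n. \<phi> (y (r n) - l)) \<longlonglongrightarrow> \<phi> 0"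
        by (simp add: linear_diff[OF lin] linear_0[OF lin])
    qed
    show "norm (T (y (r n) - l)) \<ge> e" for n
      using r(2)[of n] by (simp add: linear_diff[OF bounded_linear.linear[OF T]] dist_norm)
  qed (rule e(1))
qed

text \<open>The bump function vanishes near the origin on each line, so its Gateaux derivative there
  is 0, and any weak Hadamard derivative of the composition must vanish at each \<open>z n\<close>.
  Yet the quotients at time 1 / (n + 1) in the direction \<open>z n\<close> are at least
  \<open>e\<close>.\<close>

lemma not_completely_continuous_counterexample:
  fixes T :: "'b::real_normed_vector \<Rightarrow> 'a::real_normed_vector"
  assumes T: "bounded_linear T" and ncc: "\<not> completely_continuous T"
  obtains f :: "'a \<Rightarrow> real" where "1-lipschitz_on UNIV f" "gateaux_differentiable_at f (T 0)"
    "\<not> weak_hadamard_differentiable_at (f \<circ> T) 0"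
proof -
  obtain z c where z: "limitin weak_topology z 0 sequentially" and c: "c > 0" "\<And>n. norm (T (z n)) \<ge> c"
    using not_completely_continuous_weakly_null[OF T ncc] by blast
  have lin: "linear T" using T by (rule bounded_linear.linear)
  have T0: "T 0 = 0" by (rule linear_0[OF lin])
  define e where "e = c / 4"
  have e: "e > 0" "\<And>n. norm (T (z n)) \<ge> 4 * e" using c by (simp_all add: e_def)
  have Tz: "limitin weak_topology (\<lambda>n. T (z n)) 0 sequentially"
    unfolding limitin_weak_topology_iff
  proof (intro allI impI)
    fix \<phi> :: "'a \<Rightarrow> real" assume "bounded_linear \<phi>"
    then have "bounded_linear (\<lambda>x. \<phi> (T x))" by (rule bounded_linear_compose[OF _ T])
    with z have "(\<lambda>n. \<phi> (T (z n))) \<longlonglongrightarrow> \<phi> (T 0)" unfolding limitin_weak_topology_iff by blast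
    then show "(\<lambda>n. \<phi> (T (z n))) \<longlonglongrightarrow> \<phi> 0" by (simp add: T0)
  qed
  obtain f :: "'a \<Rightarrow> real" where f: "1-lipschitz_on UNIV f" "f 0 = 0"
    "\<And>u. \<forall>\<^sub>F t in at 0. f (t *\<^sub>R u) = 0"
    "\<And>n. f (inverse (Suc n) *\<^sub>R T (z n)) \<ge> e * inverse (Suc n)"
    using lipschitz_bumps_on_weakly_null_sequence[OF Tz e] by blast
  have "gateaux_differentiable_at f (T 0)"
    unfolding gateaux_differentiable_at_iff
  proof (intro exI conjI allI impI; (elim conjE)?)
    show "bounded_linear (\<lambda>_::'a. 0::real)" by (rule bounded_linear_zero)
    fix A :: "'a set" assume "finite A"
    then have "\<forall>\<^sub>F t in at 0. \<forall>u\<in>A. f (t *\<^sub>R u) = 0" using f(3) by (intro eventually_ball_finite) auto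
    then show "uniform_derivative_on A f (T 0) (\<lambda>_. 0)"
      unfolding uniform_derivative_on_def by (auto simp: T0 f(2) elim: eventually_mono)
  qed
  moreover have "\<not> weak_hadamard_differentiable_at (f \<circ> T) 0"
  proof
    assume "weak_hadamard_differentiable_at (f \<circ> T) 0"
    then obtain D where D: "bounded_linear D"
      "\<And>A. A \<noteq> {} \<Longrightarrow> compactin weak_topology (weak_topology closure_of A) \<Longrightarrow>
        uniform_derivative_on A (f \<circ> T) 0 D"
      unfolding weak_hadamard_differentiable_at_iff by blast
    have "uniform_derivative_on (range z) (f \<circ> T) 0 D"
      by (intro D(2) relatively_weakly_compact_sequence[OF z]) auto
    then have quot: "\<forall>\<^sub>F t in at 0. \<forall>u\<in>range z. \<bar>f (t *\<^sub>R T u) / t - D u\<bar> \<le> a" if "a > 0" for a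
      using that by (simp add: uniform_derivative_on_def T0 f(2) linear_cmul[OF lin])
    \<comment> \<open>Since \<open>f\<close> vanishes near 0 on the line through
      \<open>T (z n)\<close>, the estimate reads \<open>\<bar>D (z n)\<bar> \<le> a\<close>, free of
      \<open>t\<close>, for every \<open>a > 0\<close>.\<close>
    have D0: "D (z n) = 0" for n
    proof -
      have "\<bar>D (z n)\<bar> \<le> a" if "a > 0" for a
      proof -
        from quot[OF that] have "\<forall>\<^sub>F t in at (0::real). \<bar>D (z n)\<bar> \<le> a"
          using f(3)[of "T (z n)"]
        proof eventually_elim
          fix t assume "\<forall>u\<in>range z. \<bar>f (t *\<^sub>R T u) / t - D u\<bar> \<le> a" and 0: "f (t *\<^sub>R T (z n)) = 0"
          then have "\<bar>f (t *\<^sub>R T (z n)) / t - D (z n)\<bar> \<le> a" by blast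
          with 0 show "\<bar>D (z n)\<bar> \<le> a" by simp
        qed
        then show ?thesis by (simp add: eventually_const)
      qed
      then have "\<bar>D (z n)\<bar> \<le> 0" by (rule field_le_epsilon) simp
      then show ?thesis by simp
    qed
    have "\<forall>\<^sub>F t in at 0. \<forall>u\<in>range z. \<bar>f (t *\<^sub>R T u) / t - D u\<bar> \<le> e / 2"
      using e(1) by (intro quot) simp
    moreover have "filterlim (\<lambda>n. inverse (real (Suc n))) (at 0) sequentially"
      using LIMSEQ_inverse_real_of_nat by (simp add: filterlim_at)
    ultimately have "\<forall>\<^sub>F n in sequentially. \<forall>u\<in>range z.
        \<bar>f (inverse (real (Suc n)) *\<^sub>R T u) / inverse (real (Suc n)) - D u\<bar> \<le> e / 2"
      by (rule eventually_compose_filterlim)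
    \<comment> \<open>Uniformity over \<open>range z\<close> allows the direction to depend on
      \<open>n\<close>: time 1 / (n + 1) is paired with \<open>z n\<close>.\<close>
    then obtain n where "\<bar>f (inverse (real (Suc n)) *\<^sub>R T (z n)) / inverse (real (Suc n)) - D (z n)\<bar> \<le> e / 2"
      unfolding eventually_sequentially by blast
    then have "f (inverse (real (Suc n)) *\<^sub>R T (z n)) / inverse (real (Suc n)) \<le> e / 2"
      by (simp only: D0 diff_0_right)
    moreover have "e \<le> f (inverse (real (Suc n)) *\<^sub>R T (z n)) / inverse (real (Suc n))"
      using f(4)[of n] by (subst pos_le_divide_eq) auto
    ultimately show False using e(1) by linarith
  qed
  ultimately show ?thesis using f(1) that by blast
qed

theorem theorem1p4:
  fixes T :: "'b::banach \<Rightarrow> 'a::banach"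
  assumes "bounded_linear T"
  shows "(completely_continuous T \<longleftrightarrow>
            (\<forall>(f :: 'a \<Rightarrow> real) y. (\<exists>L. L-lipschitz_on UNIV f) \<longrightarrow>
               gateaux_differentiable_at f (T y) \<longrightarrow>
               weak_hadamard_differentiable_at (f \<circ> T) y)) \<and>
         (\<forall>(f :: 'a \<Rightarrow> real) y. (\<exists>L. L-lipschitz_on UNIV f) \<longrightarrow>
            (gateaux_differentiable_at f (T y) \<longleftrightarrow> hadamard_differentiable_at f (T y)))"
proof (intro conjI iffI allI impI; (elim exE)?)
  \<comment> \<open>Failure of complete continuity contradicts the assumption already for a
    1-Lipschitz function at the point 0.\<close>
  show "completely_continuous T"
    if "\<forall>(f :: 'a \<Rightarrow> real) y. (\<exists>L. L-lipschitz_on UNIV f) \<longrightarrow>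
      gateaux_differentiable_at f (T y) \<longrightarrow> weak_hadamard_differentiable_at (f \<circ> T) y"
    by (rule ccontr, rule not_completely_continuous_counterexample[OF assms]) (use that in blast)+
qed (use completely_continuous_imp_weak_hadamard[OF assms] lipschitz_gateaux_iff_hadamard in blast)+

end
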